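(* Let $n\ge 1$ and consider the Ziggu state graph on $n$ digits (defined in the context). A shortest solution, i.e. a solution with the fewest states, has exactly $6\cdot 2^n-3n-5$ states and therefore $6\cdot 2^n-3n-6$ moves.
   Context: Ziggu state graph on $n$ digits (this models every Ziggu puzzle with $m=n-1$ chained S-shaped mazes). Write strings over $\{0,1,2,3\}$ as $q=q_nq_{n-1}\cdots q_1$, where $q_1$ is the rightmost digit. A state is such a string in which every digit to the right of a $3$ is also a $3$; that is, for $1\le i<n$, $q_{i+1}=3$ implies $q_i=3$. Two states $q,q'$ are adjacent (they differ by one move) iff they agree in all positions except one position $i$, where $\{q_i,q'_i\}=\{a,a+1\}$ for some $a\in\{0,1,2\}$, and, if $i\ge 2$, the common digit $q_{i-1}=q'_{i-1}$ equals $3$ when $a$ is even and equals $0$ when $a$ is odd. The start state is $0^n$ and the solved state is $3^n$ (exponent denotes repetition). A solution is a sequence of pairwise distinct states beginning at $0^n$ and ending at $3^n$ in which consecutive states are adjacent. Its number of states is the length of the sequence, and its number of moves is one less. *)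

theory Defs
  imports Main
begin

text \<open>
  A string \<open>q\<^sub>n q\<^sub>n\<^sub>-\<^sub>1 \<dots> q\<^sub>1\<close> is a list in reading order, so the head is \<open>q\<^sub>n\<close>.
  Positions are counted from the right, starting at 1; \<open>digit q i\<close> is meaningful
  only for \<open>1 \<le> i \<le> length q\<close>.
\<close>

definition digit :: "nat list \<Rightarrow> nat \<Rightarrow> nat" where
  "digit q i = q ! (length q - i)"

definition ziggu_states :: "nat \<Rightarrow> nat list set" where
  "ziggu_states n = {q. length q = n \<and> set q \<subseteq> {0, 1, 2, 3} \<and>
     (\<forall>i. 1 \<le> i \<and> i < n \<longrightarrow> digit q (i + 1) = 3 \<longrightarrow> digit q i = 3)}"

definition ziggu_adj :: "nat \<Rightarrow> nat list \<Rightarrow> nat list \<Rightarrow> bool" where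
  "ziggu_adj n q q' \<longleftrightarrow> q \<in> ziggu_states n \<and> q' \<in> ziggu_states n \<and>
     (\<exists>i\<in>{1..n}. (\<forall>j\<in>{1..n}. j \<noteq> i \<longrightarrow> digit q j = digit q' j) \<and>
        (\<exists>a\<in>{0, 1, 2}. {digit q i, digit q' i} = {a, a + 1} \<and>
           (2 \<le> i \<longrightarrow> digit q (i - 1) = (if even a then 3 else 0))))"

definition ziggu_solution :: "nat \<Rightarrow> nat list list \<Rightarrow> bool" where
  "ziggu_solution n p \<longleftrightarrow> p \<noteq> [] \<and> set p \<subseteq> ziggu_states n \<and> distinct p \<and>
     hd p = replicate n 0 \<and> last p = replicate n 3 \<and> successively (ziggu_adj n) p"

definition num_states :: "nat list list \<Rightarrow> nat" where
  "num_states p = length p"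

definition num_moves :: "nat list list \<Rightarrow> nat" where
  "num_moves p = num_states p - 1"

definition shortest_ziggu_solution :: "nat \<Rightarrow> nat list list \<Rightarrow> bool" where
  "shortest_ziggu_solution n p \<longleftrightarrow> is_arg_min num_states (ziggu_solution n) p"

end

theory Submission
  imports Defs
begin

text \<open>
  The leading digit changes between \<open>0\<close> and \<open>1\<close>, or between \<open>2\<close> and \<open>3\<close>, only when all
  other digits are \<open>3\<close>, and between \<open>1\<close> and \<open>2\<close> only when the next digit is \<open>0\<close>. So a solution
  on \<open>n + 1\<close> digits solves the last \<open>n\<close> digits, takes them from \<open>3\<^sup>n\<close> to some state with
  leading \<open>0\<close>, and then back to \<open>3\<^sup>n\<close>. By the same analysis reaching a leading \<open>0\<close> from
  \<open>3\<^sup>n\<close> costs \<open>E n\<close> moves, where \<open>E (n + 1) = 2 * E n + 3\<close>, i.e. \<open>E n = 3 * 2 ^ n - 3\<close>;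
  the solution thus costs \<open>D n\<close> moves, where \<open>D (n + 1) = D n + 2 * E n + 3\<close>.
  The upper bound is an explicit path. The lower bound comes from an integer-valued potential that
  changes by at most one along each move and drops by \<open>D n\<close> from \<open>0\<^sup>n\<close> to \<open>3\<^sup>n\<close>.
\<close>

section \<open>States and moves in terms of the leading digit\<close>

lemma digit_Cons: "1 \<le> i \<Longrightarrow> i \<le> length u \<Longrightarrow> digit (d # u) i = digit u i"
  by (simp add: digit_def Suc_diff_le)

lemma digit_Cons_Suc_length [simp]: "digit (d # u) (Suc (length u)) = d"
  by (simp add: digit_def)

lemma digit_length: "u \<noteq> [] \<Longrightarrow> digit u (length u) = hd u"
  by (simp add: digit_def hd_conv_nth)

lemma eq_if_digits_eq:
  assumes "length u = n" "length v = n" "\<forall>j\<in>{1..n}. digit u j = digit v j"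
  shows "u = v"
proof (rule nth_equalityI)
  fix k assume "k < length u"
  then have "n - k \<in> {1..n}" "n - (n - k) = k" using assms by auto
  then show "u ! k = v ! k" using assms unfolding digit_def by metis
qed (use assms in simp)

lemma ziggu_states_0: "ziggu_states 0 = {[]}"
  by (auto simp: ziggu_states_def)

lemma length_ziggu_states: "q \<in> ziggu_states n \<Longrightarrow> length q = n"
  by (simp add: ziggu_states_def)

lemma ziggu_states_SucE:
  assumes "q \<in> ziggu_states (Suc n)"
  obtains d u where "q = d # u"
  using assms by (cases q) (auto dest: length_ziggu_states)

lemma Cons_in_ziggu_states_iff:
  "d # u \<in> ziggu_states (Suc n) \<longleftrightarrow>
     u \<in> ziggu_states n \<and> d \<in> {0, 1, 2, 3} \<and> (d = 3 \<longrightarrow> u \<noteq> [] \<longrightarrow> hd u = 3)"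
  (is "?L \<longleftrightarrow> ?R")
proof (cases "length u = n")
  case True
  have "(\<forall>i. 1 \<le> i \<and> i < Suc n \<longrightarrow> digit (d # u) (i + 1) = 3 \<longrightarrow> digit (d # u) i = 3) \<longleftrightarrow>
    (\<forall>i. 1 \<le> i \<and> i < n \<longrightarrow> digit u (i + 1) = 3 \<longrightarrow> digit u i = 3) \<and>
    (d = 3 \<longrightarrow> u \<noteq> [] \<longrightarrow> hd u = 3)" (is "(\<forall>i. ?P i) \<longleftrightarrow> (\<forall>i. ?Q i) \<and> ?C")
  proof -
    have low: "?P i \<longleftrightarrow> ?Q i" if "i \<noteq> n" for i
      using that True by (auto simp: digit_Cons)
    \<comment> \<open>The top constraint is vacuous for \<open>n = 0\<close>, which is the case
      \<open>u = []\<close>; likewise \<open>?Q n\<close> holds vacuously.\<close>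
    have top: "?P n \<longleftrightarrow> ?C"
      using True by (cases "u = []") (auto simp: digit_Cons digit_length Suc_le_eq)
    have "?Q n" by simp
    with low top show ?thesis by metis
  qed
  then show ?thesis
    using True unfolding ziggu_states_def by auto
qed (auto simp: ziggu_states_def)

lemma replicate_3_in_ziggu_states: "replicate n 3 \<in> ziggu_states n"
  by (induction n) (auto simp: ziggu_states_0 Cons_in_ziggu_states_iff hd_replicate)

text \<open>The condition on a move concerns position \<open>i - 1\<close>, where both states agree,
  so it may be read off either of them.\<close>

lemma ziggu_adj_sym: "ziggu_adj n q q' \<Longrightarrow> ziggu_adj n q' q"
proof -
  assume "ziggu_adj n q q'"
  then obtain i a where q: "q \<in> ziggu_states n" "q' \<in> ziggu_states n"
    and i: "i \<in> {1..n}" "\<forall>j\<in>{1..n}. j \<noteq> i \<longrightarrow> digit q j = digit q' j"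
    and a: "a \<in> {0, 1, 2}" "{digit q i, digit q' i} = {a, a + 1}"
      "2 \<le> i \<longrightarrow> digit q (i - 1) = (if even a then 3 else 0)"
    unfolding ziggu_adj_def by blast
  have "2 \<le> i \<longrightarrow> digit q' (i - 1) = digit q (i - 1)"
    using i(1) by (auto intro!: i(2)[rule_format, symmetric])
  moreover have "{digit q' i, digit q i} = {a, a + 1}"
    using a(2) by (simp add: insert_commute)
  ultimately show ?thesis
    unfolding ziggu_adj_def using q i a by metis
qed

definition lead_move :: "nat \<Rightarrow> nat \<Rightarrow> nat list \<Rightarrow> bool" where
  "lead_move d d' u \<longleftrightarrow> (\<exists>a\<in>{0, 1, 2}. {d, d'} = {a, a + 1} \<and>
     (u \<noteq> [] \<longrightarrow> hd u = (if even a then 3 else 0)))"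

text \<open>A move at a lower position depends only on digits of the tail, a move at the top
  position only on the two leading digits and the head of the tail. Membership stays on the right
  because under a leading \<open>3\<close> the tail cannot leave the all-\<open>3\<close>
  string.\<close>

lemma ziggu_adj_Cons_iff:
  "ziggu_adj (Suc n) (d # u) (d' # u') \<longleftrightarrow>
     d # u \<in> ziggu_states (Suc n) \<and> d' # u' \<in> ziggu_states (Suc n) \<and>
     (d = d' \<and> ziggu_adj n u u' \<or> u = u' \<and> lead_move d d' u)"
proof (cases "d # u \<in> ziggu_states (Suc n) \<and> d' # u' \<in> ziggu_states (Suc n)")
  case True
  then have u: "u \<in> ziggu_states n" "u' \<in> ziggu_states n"
    by (auto simp: Cons_in_ziggu_states_iff)
  then have len: "length u = n" "length u' = n"
    by (auto dest: length_ziggu_states)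
  define M where "M q q' i \<longleftrightarrow> (\<exists>a\<in>{0, 1, 2}. {digit q i, digit q' i} = {a, a + 1} \<and>
    (2 \<le> i \<longrightarrow> digit q (i - 1) = (if even a then 3 else 0)))" for q q' i
  have low: "digit (d # u) j = digit u j" "digit (d' # u') j = digit u' j" if "j \<in> {1..n}" for j
    using that len by (auto simp: digit_Cons)
  have top: "digit (d # u) (Suc n) = d" "digit (d' # u') (Suc n) = d'"
    using digit_Cons_Suc_length[of d u] digit_Cons_Suc_length[of d' u'] len by simp_all
  have M_low: "M (d # u) (d' # u') i \<longleftrightarrow> M u u' i" if "i \<in> {1..n}" for i
  proof -
    have "2 \<le> i \<longrightarrow> digit (d # u) (i - 1) = digit u (i - 1)"
      using that by (auto intro!: low)
    then show ?thesis
      unfolding M_def low[OF that] by metis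
  qed
  have M_top: "M (d # u) (d' # u') (Suc n) \<longleftrightarrow> lead_move d d' u"
  proof -
    have "(2 \<le> Suc n) = (u \<noteq> [])" "u \<noteq> [] \<longrightarrow> digit (d # u) (Suc n - 1) = hd u"
      using len low[of n] digit_length[of u] by (auto simp: Suc_le_eq)
    then show ?thesis
      unfolding M_def lead_move_def top by metis
  qed
  have split: "{1..Suc n} = insert (Suc n) {1..n}"
    by auto
  have bex_split: "(\<exists>i\<in>{1..Suc n}. F i) \<longleftrightarrow> F (Suc n) \<or> (\<exists>i\<in>{1..n}. F i)" for F
    unfolding split by blast
  have agree_top: "(\<forall>j\<in>{1..Suc n}. j \<noteq> Suc n \<longrightarrow> digit (d # u) j = digit (d' # u') j) \<longleftrightarrow> u = u'"
  proof -
    have "(\<forall>j\<in>{1..Suc n}. j \<noteq> Suc n \<longrightarrow> digit (d # u) j = digit (d' # u') j) \<longleftrightarrow>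
      (\<forall>j\<in>{1..n}. digit u j = digit u' j)"
      unfolding split using low by auto
    also have "\<dots> \<longleftrightarrow> u = u'"
      using eq_if_digits_eq[OF len] by auto
    finally show ?thesis .
  qed
  have agree_low: "(\<forall>j\<in>{1..Suc n}. j \<noteq> i \<longrightarrow> digit (d # u) j = digit (d' # u') j) \<longleftrightarrow>
      d = d' \<and> (\<forall>j\<in>{1..n}. j \<noteq> i \<longrightarrow> digit u j = digit u' j)" if "i \<in> {1..n}" for i
    unfolding split using low top that by auto
  have "ziggu_adj (Suc n) (d # u) (d' # u') \<longleftrightarrow>
    (\<exists>i\<in>{1..Suc n}. (\<forall>j\<in>{1..Suc n}. j \<noteq> i \<longrightarrow> digit (d # u) j = digit (d' # u') j) \<and>
       M (d # u) (d' # u') i)"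
    using True unfolding ziggu_adj_def M_def by blast
  also have "\<dots> \<longleftrightarrow> u = u' \<and> lead_move d d' u \<or>
    (\<exists>i\<in>{1..n}. (\<forall>j\<in>{1..Suc n}. j \<noteq> i \<longrightarrow> digit (d # u) j = digit (d' # u') j) \<and>
       M (d # u) (d' # u') i)"
    unfolding bex_split agree_top M_top ..
  also have "\<dots> \<longleftrightarrow> u = u' \<and> lead_move d d' u \<or>
    (\<exists>i\<in>{1..n}. (d = d' \<and> (\<forall>j\<in>{1..n}. j \<noteq> i \<longrightarrow> digit u j = digit u' j)) \<and> M u u' i)"
    by (intro disj_cong bex_cong conj_cong refl agree_low M_low)
  also have "\<dots> \<longleftrightarrow> u = u' \<and> lead_move d d' u \<or> d = d' \<and> ziggu_adj n u u'"
    using u unfolding ziggu_adj_def M_def by blast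
  finally show ?thesis
    using True by blast
qed (auto simp: ziggu_adj_def)

lemma lead_move_iff:
  "lead_move d d' u \<longleftrightarrow>
     ({d, d'} = {0, 1} \<or> {d, d'} = {2, 3}) \<and> (u \<noteq> [] \<longrightarrow> hd u = 3) \<or>
     {d, d'} = {1, 2} \<and> (u \<noteq> [] \<longrightarrow> hd u = 0)"
  by (auto simp: lead_move_def numeral_3_eq_3 numeral_2_eq_2)

section \<open>The potential and the lower bound\<close>

text \<open>A lower bound on the distance to \<open>3\<^sup>n\<close>, cut off at \<open>E n\<close>: without the cut-off its value on
  the states with leading \<open>0\<close>, where digit \<open>1\<close> may turn into \<open>2\<close>, would not be constant.\<close>

fun capped_pot :: "nat list \<Rightarrow> int" where
  "capped_pot [] = 0"
| "capped_pot (d # u) =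
     (if d = 3 then 0 else if d = 2 then 1 + capped_pot u
      else if d = 1 then 6 * 2 ^ length u - 4 - capped_pot u else 6 * 2 ^ length u - 3)"

text \<open>Under a leading \<open>0\<close> the tail has to be solved first, which
  \<open>pot u\<close> measures; the added constant is \<open>2 * E n + 3\<close> for
  \<open>n = length u\<close>, the cost of everything after that.\<close>

fun pot :: "nat list \<Rightarrow> int" where
  "pot [] = 0"
| "pot (d # u) = (if d = 0 then 6 * 2 ^ length u - 3 + pot u else capped_pot (d # u))"

lemma capped_pot_hd_3: "(u \<noteq> [] \<longrightarrow> hd u = 3) \<Longrightarrow> capped_pot u = 0"
  by (cases u) auto

lemma capped_pot_hd_0: "(u \<noteq> [] \<longrightarrow> hd u = 0) \<Longrightarrow> capped_pot u = 3 * 2 ^ length u - 3"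
  by (cases u) auto

lemma pot_hd_3: "(u \<noteq> [] \<longrightarrow> hd u = 3) \<Longrightarrow> pot u = 0"
  by (cases u) auto

lemma pot_replicate_0: "pot (replicate n 0) = 6 * 2 ^ n - 3 * int n - 6"
  by (induction n) auto

lemma ziggu_adj_length: "ziggu_adj n u v \<Longrightarrow> length u = n \<and> length v = n"
  by (auto simp: ziggu_adj_def dest: length_ziggu_states)

lemma not_ziggu_adj_0: "\<not> ziggu_adj 0 u v"
  by (simp add: ziggu_adj_def)

lemma ziggu_adj_Suc_cases:
  assumes "ziggu_adj (Suc n) q q'"
  obtains (low) d u u' where "q = d # u" "q' = d # u'" "ziggu_adj n u u'"
  | (top) d d' u where "q = d # u" "q' = d' # u" "lead_move d d' u"
proof -
  have "q \<in> ziggu_states (Suc n)" "q' \<in> ziggu_states (Suc n)"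
    using assms by (auto simp: ziggu_adj_def)
  then obtain d u d' u' where "q = d # u" "q' = d' # u'"
    by (metis ziggu_states_SucE)
  then show thesis
    using assms low top by (auto simp: ziggu_adj_Cons_iff)
qed

text \<open>A move in the tail is handled by induction, since \<open>capped_pot u\<close> enters
  with coefficient 0, 1 or -1. A leading move forces the head of \<open>u\<close> to be 3 or 0,
  hence \<open>capped_pot u\<close> to be 0 or \<open>E n\<close>; between leading digits 1 and 2
  the values are then \<open>E n + 2\<close> and \<open>E n + 1\<close>.\<close>

lemma capped_pot_lipschitz: "ziggu_adj n q q' \<Longrightarrow> \<bar>capped_pot q - capped_pot q'\<bar> \<le> 1"
proof (induction n arbitrary: q q')
  case (Suc n)
  from Suc.prems show ?case
  proof (cases rule: ziggu_adj_Suc_cases)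
    case (low d u u')
    then show ?thesis
      using Suc.IH[of u u'] ziggu_adj_length[of n u u'] by auto
  next
    case (top d d' u)
    from top(3) show ?thesis
      unfolding lead_move_iff top(1,2)
      by (auto simp: doubleton_eq_iff capped_pot_hd_3 capped_pot_hd_0)
  qed
qed (simp add: not_ziggu_adj_0)

text \<open>\<open>pot\<close> and \<open>capped_pot\<close> differ only under a leading
  \<open>0\<close>, and the two regimes meet only in leading moves between 0 and 1, where the head
  of the tail is 3 and both potentials of the tail vanish.\<close>

lemma pot_lipschitz: "ziggu_adj n q q' \<Longrightarrow> \<bar>pot q - pot q'\<bar> \<le> 1"
proof (induction n arbitrary: q q')
  case (Suc n)
  from Suc.prems show ?case
  proof (cases rule: ziggu_adj_Suc_cases)
    case (low d u u')
    then show ?thesis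
      using Suc.IH[of u u'] capped_pot_lipschitz[OF Suc.prems] ziggu_adj_length[of n u u'] by auto
  next
    case (top d d' u)
    from top(3) show ?thesis
      unfolding lead_move_iff top(1,2)
      by (auto simp: doubleton_eq_iff pot_hd_3 capped_pot_hd_3 capped_pot_hd_0)
  qed
qed (simp add: not_ziggu_adj_0)

lemma successively_lipschitz:
  fixes f :: "'a \<Rightarrow> int"
  assumes "\<And>x y. R x y \<Longrightarrow> \<bar>f x - f y\<bar> \<le> 1"
  shows "p \<noteq> [] \<Longrightarrow> successively R p \<Longrightarrow> f (hd p) - f (last p) \<le> int (length p) - 1"
proof (induction p rule: induct_list012)
  case (3 x y p)
  then show ?case using assms[of x y] by auto
qed auto

lemma ziggu_solution_length_ge:
  assumes "ziggu_solution n p"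
  shows "int (length p) \<ge> 6 * 2 ^ n - 3 * int n - 5"
proof -
  have "pot (hd p) - pot (last p) \<le> int (length p) - 1"
    using assms unfolding ziggu_solution_def
    by (intro successively_lipschitz[where R = "ziggu_adj n"] pot_lipschitz) blast+
  then show ?thesis
    using assms by (simp add: ziggu_solution_def pot_replicate_0 pot_hd_3 hd_replicate)
qed

section \<open>Explicit paths and the upper bound\<close>

text \<open>The tail goes from all \<open>3\<close> to a leading \<open>0\<close>, which lets the
  leading 2 become 1, and then retraces its steps so that 1 can become 0.\<close>

fun path_to_lead_0 :: "nat \<Rightarrow> nat list list" where
  "path_to_lead_0 0 = [[]]"
| "path_to_lead_0 (Suc n) =
     [replicate (Suc n) 3] @ map ((#) 2) (path_to_lead_0 n) @
     map ((#) 1) (rev (path_to_lead_0 n)) @ [0 # replicate n 3]"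

fun solution_path :: "nat \<Rightarrow> nat list list" where
  "solution_path 0 = [[]]"
| "solution_path (Suc n) =
     map ((#) 0) (solution_path n) @ map ((#) 1) (path_to_lead_0 n) @
     map ((#) 2) (rev (path_to_lead_0 n)) @ [replicate (Suc n) 3]"

lemma path_to_lead_0_nonempty [simp]: "path_to_lead_0 n \<noteq> []"
  by (cases n) auto

lemma hd_path_to_lead_0 [simp]: "hd (path_to_lead_0 n) = replicate n 3"
  by (cases n) auto

lemma hd_last_path_to_lead_0: "last (path_to_lead_0 n) \<noteq> [] \<Longrightarrow> hd (last (path_to_lead_0 n)) = 0"
  by (cases n) auto

lemma path_to_lead_0_in_ziggu_states: "set (path_to_lead_0 n) \<subseteq> ziggu_states n"
  by (induction n)
    (auto simp: ziggu_states_0 Cons_in_ziggu_states_iff replicate_3_in_ziggu_states hd_replicate)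

lemma distinct_path_to_lead_0: "distinct (path_to_lead_0 n)"
  by (induction n) (auto simp: distinct_map)

lemma length_path_to_lead_0: "int (length (path_to_lead_0 n)) = 3 * 2 ^ n - 2"
  by (induction n) auto

lemma successively_ziggu_adj_rev:
  "successively (ziggu_adj n) p \<Longrightarrow> successively (ziggu_adj n) (rev p)"
  by (auto simp: successively_rev intro: successively_mono ziggu_adj_sym)

text \<open>A leading digit below 3 puts no constraint on the tail.\<close>

lemma successively_ziggu_adj_map_Cons:
  assumes "successively (ziggu_adj n) p" "d < 3"
  shows "successively (ziggu_adj (Suc n)) (map ((#) d) p)"
  unfolding successively_map using assms(1)
proof (rule successively_mono)
  fix u v assume "ziggu_adj n u v"
  then have "u \<in> ziggu_states n" "v \<in> ziggu_states n" by (auto simp: ziggu_adj_def)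
  then show "ziggu_adj (Suc n) (d # u) (d # v)"
    using \<open>ziggu_adj n u v\<close> assms(2) by (auto simp: ziggu_adj_Cons_iff Cons_in_ziggu_states_iff)
qed

lemma lead_move_adj:
  assumes "u \<in> ziggu_states n"
  shows "u = replicate n 3 \<Longrightarrow> ziggu_adj (Suc n) (0 # u) (1 # u)"
    and "u = replicate n 3 \<Longrightarrow> ziggu_adj (Suc n) (2 # u) (3 # u)"
    and "(u \<noteq> [] \<Longrightarrow> hd u = 0) \<Longrightarrow> ziggu_adj (Suc n) (1 # u) (2 # u)"
  using assms
  by (auto simp: ziggu_adj_Cons_iff lead_move_iff Cons_in_ziggu_states_iff hd_replicate)

lemma last_path_to_lead_0_adj:
  "ziggu_adj (Suc n) (1 # last (path_to_lead_0 n)) (2 # last (path_to_lead_0 n))"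
  using path_to_lead_0_in_ziggu_states last_in_set[OF path_to_lead_0_nonempty]
  by (intro lead_move_adj hd_last_path_to_lead_0) blast+

lemma successively_path_to_lead_0: "successively (ziggu_adj n) (path_to_lead_0 n)"
proof (induction n)
  case (Suc n)
  note adj = lead_move_adj(1,2)[OF replicate_3_in_ziggu_states refl, of n]
  have "successively (ziggu_adj (Suc n)) (map ((#) 2) (path_to_lead_0 n))"
    "successively (ziggu_adj (Suc n)) (map ((#) 1) (rev (path_to_lead_0 n)))"
    using Suc by (intro successively_ziggu_adj_map_Cons successively_ziggu_adj_rev; simp)+
  then show ?case
    \<comment> \<open>Only the three joints between blocks remain: the leading moves 3 to 2, 2 to 1
      and 1 to 0, each the reverse of a move already established.\<close>
    using last_path_to_lead_0_adj[of n, THEN ziggu_adj_sym] adj[THEN ziggu_adj_sym]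
    by (simp add: successively_append_iff successively_Cons hd_map last_map hd_rev last_rev
        hd_append del: successively_map successively_rev)
qed simp

lemma hd_solution_path: "hd (solution_path n) = replicate n 0 \<and> solution_path n \<noteq> []"
  by (induction n) (auto simp: hd_append hd_map)

lemma last_solution_path: "last (solution_path n) = replicate n 3"
  by (cases n) auto

lemma ziggu_solution_solution_path: "ziggu_solution n (solution_path n)"
proof (induction n)
  case 0
  then show ?case by (simp add: ziggu_solution_def ziggu_states_0)
next
  case (Suc n)
  then have IH: "set (solution_path n) \<subseteq> ziggu_states n" "distinct (solution_path n)"
    "successively (ziggu_adj n) (solution_path n)"
    by (auto simp: ziggu_solution_def)
  note adj = lead_move_adj(1,2)[OF replicate_3_in_ziggu_states refl, of n]
  have "set (solution_path (Suc n)) \<subseteq> ziggu_states (Suc n)"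
    using IH path_to_lead_0_in_ziggu_states[of n]
    by (auto simp: Cons_in_ziggu_states_iff replicate_3_in_ziggu_states hd_replicate)
  moreover have "distinct (solution_path (Suc n))"
    using IH distinct_path_to_lead_0[of n] by (auto simp: distinct_map)
  moreover have "successively (ziggu_adj (Suc n)) (solution_path (Suc n))"
  proof -
    have "successively (ziggu_adj (Suc n)) (map ((#) 0) (solution_path n))"
      "successively (ziggu_adj (Suc n)) (map ((#) 1) (path_to_lead_0 n))"
      "successively (ziggu_adj (Suc n)) (map ((#) 2) (rev (path_to_lead_0 n)))"
      using IH(3) successively_path_to_lead_0[of n]
      by (intro successively_ziggu_adj_map_Cons successively_ziggu_adj_rev; simp)+
    then show ?thesis
      using last_path_to_lead_0_adj[of n] adj hd_solution_path[of n]
      by (simp add: successively_append_iff hd_map last_map hd_rev last_rev hd_append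
          last_solution_path del: successively_map successively_rev)
  qed
  ultimately show ?case
    using hd_solution_path[of "Suc n"] last_solution_path[of "Suc n"]
    unfolding ziggu_solution_def by blast
qed

lemma length_solution_path: "int (length (solution_path n)) = 6 * 2 ^ n - 3 * int n - 5"
  by (induction n) (auto simp: length_path_to_lead_0)

theorem theorem4p3:
  fixes n :: nat
  assumes "n \<ge> 1"
  shows "(\<exists>p. shortest_ziggu_solution n p) \<and>
    (\<forall>p. shortest_ziggu_solution n p \<longrightarrow>
       int (num_states p) = 6 * 2 ^ n - 3 * int n - 5 \<and>
       int (num_moves p) = 6 * 2 ^ n - 3 * int n - 6)"
proof (intro conjI allI impI)
  have "num_states (solution_path n) \<le> num_states p" if "ziggu_solution n p" for p
    using ziggu_solution_length_ge[OF that] length_solution_path[of n] by (simp add: num_states_def)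
  then show "\<exists>p. shortest_ziggu_solution n p"
    unfolding shortest_ziggu_solution_def is_arg_min_linorder
    using ziggu_solution_solution_path by blast
next
  fix p assume "shortest_ziggu_solution n p"
  then have p: "ziggu_solution n p" and "num_states p \<le> num_states (solution_path n)"
    using ziggu_solution_solution_path
    by (auto simp: shortest_ziggu_solution_def is_arg_min_linorder)
  then show len: "int (num_states p) = 6 * 2 ^ n - 3 * int n - 5"
    using ziggu_solution_length_ge[OF p] length_solution_path[of n] by (simp add: num_states_def)
  \<comment> \<open>This makes the truncated subtraction in \<open>num_moves\<close> exact.\<close>
  have "num_states p \<ge> 1"
    using p by (simp add: ziggu_solution_def num_states_def Suc_le_eq)
  then show "int (num_moves p) = 6 * 2 ^ n - 3 * int n - 6"
    using len by (simp add: num_moves_def)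
qed

end
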